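(* For each of the triplets $(e,e,e)$, $(e,e,12)$, $(e,e,13)$, $(e,e,23)$, $(e,13,e)$, $(e,13,13)$, $(e,13,23)$, $(e,132,e)$, $(e,132,12)$, $(e,132,13)$, $(e,132,23)$, the minimal terms of the TRIP-Stern tree lie on the right-most path: for every $n\ge0$, the minimum $b_n=\min_{|v|=n}\min_i b_i(v)$ is attained as an entry of $(1,1,1)F_1^n$.
   Context: Let $A_0=\begin{pmatrix}0&0&1\\1&0&0\\0&1&1\end{pmatrix}$, $A_1=\begin{pmatrix}1&0&1\\0&1&0\\0&0&1\end{pmatrix}$. Elements of $S_3$ are identified with permutation matrices: $e=I$, $(12)=\begin{pmatrix}0&1&0\\1&0&0\\0&0&1\end{pmatrix}$, $(13)=\begin{pmatrix}0&0&1\\0&1&0\\1&0&0\end{pmatrix}$, $(23)=\begin{pmatrix}1&0&0\\0&0&1\\0&1&0\end{pmatrix}$, $(123)=\begin{pmatrix}0&1&0\\0&0&1\\1&0&0\end{pmatrix}$, $(132)=\begin{pmatrix}0&0&1\\1&0&0\\0&1&0\end{pmatrix}$. For $(\sigma,\tau_0,\tau_1)\in S_3^3$ put $F_0=\sigma A_0\tau_0$, $F_1=\sigma A_1\tau_1$. For $v=(i_1,\dots,i_n)\in\{0,1\}^n$ let $\triangle(v)=(1,1,1)F_{i_1}\cdots F_{i_n}=(b_1(v),b_2(v),b_3(v))$; level $n$ of the TRIP-Stern tree consists of the $\triangle(v)$ with $|v|=n$, and the right-most node of level $n$ is $(1,1,1)F_1^n$. *)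

theory Defs
  imports "HOL-Analysis.Analysis"
begin

type_synonym mat3 = "int ^ 3 ^ 3"

definition A0 :: mat3 where
  "A0 = vector [vector [0, 0, 1], vector [1, 0, 0], vector [0, 1, 1]]"

definition A1 :: mat3 where
  "A1 = vector [vector [1, 0, 1], vector [0, 1, 0], vector [0, 0, 1]]"

text \<open>
  The elements of the symmetric group on three letters, identified with permutation matrices.
  The identification is fixed by this table (rows are listed from top to bottom).
\<close>

definition p_e :: mat3 where
  "p_e = mat 1"

definition p_12 :: mat3 where
  "p_12 = vector [vector [0, 1, 0], vector [1, 0, 0], vector [0, 0, 1]]"

definition p_13 :: mat3 where
  "p_13 = vector [vector [0, 0, 1], vector [0, 1, 0], vector [1, 0, 0]]"

definition p_23 :: mat3 where
  "p_23 = vector [vector [1, 0, 0], vector [0, 0, 1], vector [0, 1, 0]]"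

definition p_123 :: mat3 where
  "p_123 = vector [vector [0, 1, 0], vector [0, 0, 1], vector [1, 0, 0]]"

definition p_132 :: mat3 where
  "p_132 = vector [vector [0, 0, 1], vector [1, 0, 0], vector [0, 1, 0]]"

definition F0 :: "mat3 \<times> mat3 \<times> mat3 \<Rightarrow> mat3" where
  "F0 = (\<lambda>(\<sigma>, \<tau>0, \<tau>1). \<sigma> ** A0 ** \<tau>0)"

definition F1 :: "mat3 \<times> mat3 \<times> mat3 \<Rightarrow> mat3" where
  "F1 = (\<lambda>(\<sigma>, \<tau>0, \<tau>1). \<sigma> ** A1 ** \<tau>1)"

definition F :: "mat3 \<times> mat3 \<times> mat3 \<Rightarrow> nat \<Rightarrow> mat3" where
  "F t i = (if i = 0 then F0 t else F1 t)"

definition words :: "nat \<Rightarrow> nat list set" where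
  "words n = {v. set v \<subseteq> {0, 1} \<and> length v = n}"

definition ones :: "int ^ 3" where
  "ones = vector [1, 1, 1]"

definition triangle :: "mat3 \<times> mat3 \<times> mat3 \<Rightarrow> nat list \<Rightarrow> int ^ 3" where
  "triangle t v = ones v* foldr (**) (map (F t) v) (mat 1)"

text \<open>
  The library's power \<open>^\<close> on the type of matrices is the componentwise one, so the power with
  respect to the matrix product is defined here.
\<close>

primrec mat_pow :: "mat3 \<Rightarrow> nat \<Rightarrow> mat3" where
  "mat_pow M 0 = mat 1"
| "mat_pow M (Suc n) = M ** mat_pow M n"

definition rightmost_node :: "mat3 \<times> mat3 \<times> mat3 \<Rightarrow> nat \<Rightarrow> int ^ 3" where
  "rightmost_node t n = ones v* mat_pow (F1 t) n"

definition min_term :: "mat3 \<times> mat3 \<times> mat3 \<Rightarrow> nat \<Rightarrow> int" where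
  "min_term t n = Min ((\<lambda>v. Min (range (\<lambda>i. triangle t v $ i))) ` words n)"

text \<open>The minimum ranges over a finite nonempty set of words, so \<open>Min\<close> is meaningful.\<close>

lemma finite_words: "finite (words n)"
  unfolding words_def by (rule finite_lists_length_eq) simp

lemma replicate_in_words: "replicate n 1 \<in> words n"
  by (auto simp: words_def)

lemma words_nonempty: "words n \<noteq> {}"
  using replicate_in_words by blast

lemma rightmost_node_eq_triangle: "rightmost_node t n = triangle t (replicate n 1)"
proof -
  have "foldr (**) (map (F t) (replicate n 1)) (mat 1) = mat_pow (F1 t) n"
    by (induction n) (simp_all add: F_def)
  then show ?thesis
    by (simp add: rightmost_node_def triangle_def)
qed

end

theory Submission
  imports Defs
begin

text \<open>
  All eleven triplets have \<open>b\<^sub>n = 1\<close>: every node has positive entries, and the right-most path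
  never loses the entry 1, because right multiplication by \<open>F\<^sub>1\<close> fixes the first entry
  (\<open>\<tau>\<^sub>1 = (23)\<close>), fixes the second one (\<open>\<tau>\<^sub>1 = (13)\<close>), or permutes these two
  (\<open>\<tau>\<^sub>1 = e, (12)\<close>).
\<close>

lemma vector_matrix_mult_3:
  fixes w :: "'a::semiring_1 ^ 3" and M :: "'a ^ 3 ^ 3"
  shows "(w v* M) $ j = w $ 1 * M $ 1 $ j + w $ 2 * M $ 2 $ j + w $ 3 * M $ 3 $ j"
  by (simp add: vector_matrix_mult_def sum_3)

lemma vector_matrix_mult_A0: "w v* A0 = vector [w $ 2, w $ 3, w $ 1 + w $ 3]"
  by (simp add: vec_eq_iff forall_3 vector_matrix_mult_3 A0_def)

lemma vector_matrix_mult_A1: "w v* A1 = vector [w $ 1, w $ 2, w $ 1 + w $ 3]"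
  by (simp add: vec_eq_iff forall_3 vector_matrix_mult_3 A1_def)

lemma vector_matrix_mult_perm:
  fixes w :: "int ^ 3"
  shows "w v* p_e = w"
    and "w v* p_12 = vector [w $ 2, w $ 1, w $ 3]"
    and "w v* p_13 = vector [w $ 3, w $ 2, w $ 1]"
    and "w v* p_23 = vector [w $ 1, w $ 3, w $ 2]"
    and "w v* p_132 = vector [w $ 2, w $ 3, w $ 1]"
  by (simp_all add: vec_eq_iff forall_3 vector_matrix_mult_3 p_e_def mat_def
      p_12_def p_13_def p_23_def p_132_def)

text \<open>Reassociated so that a row vector passes through one factor at a time and the entrywise
  formulas above apply as rewrite rules.\<close>

lemma vector_matrix_mult_F:
  "w v* F (\<sigma>, \<tau>0, \<tau>1) i = (if i = 0 then w v* \<sigma> v* A0 v* \<tau>0 else w v* \<sigma> v* A1 v* \<tau>1)"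
  by (simp add: F_def F0_def F1_def vector_matrix_mul_assoc)

text \<open>The leftmost factor of the product acts first on \<open>ones\<close>, so reading the
  word from the left is a walk on row vectors. Restricting \<open>step\<close> to letters of
  \<open>v\<close> admits invariants of \<open>F1\<close> alone.\<close>

lemma triangle_invariant:
  assumes "P ones" and step: "\<And>w i. i \<in> set v \<Longrightarrow> P w \<Longrightarrow> P (w v* F t i)"
  shows "P (triangle t v)"
proof -
  have "P (w v* foldr (**) (map (F t) v) (mat 1))" if "P w" for w
    \<comment> \<open>\<open>step\<close> depends on the word through \<open>set v\<close>, so it
      has to enter the induction.\<close>
    using step that
  proof (induction v arbitrary: w)
    case (Cons i v)
    then have "P (w v* F t i v* foldr (**) (map (F t) v) (mat 1))"
      by simp
    then show ?case
      by (simp add: vector_matrix_mul_assoc)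
  qed simp
  then show ?thesis
    using \<open>P ones\<close> by (simp add: triangle_def)
qed

lemma ones_nth [simp]: "ones $ i = 1"
  using forall_3[of "\<lambda>i. ones $ i = 1"] by (simp add: ones_def)

text \<open>Each new entry is an old entry or the sum of two old entries.\<close>

lemma triangle_pos:
  assumes "t \<in> {p_e} \<times> {p_e, p_13, p_132} \<times> {p_e, p_12, p_13, p_23}"
  shows "triangle t v $ i > 0"
proof -
  have "\<forall>i. triangle t v $ i > 0"
    by (rule triangle_invariant)
      (use assms in \<open>auto simp: forall_3 vector_matrix_mult_F vector_matrix_mult_A0
        vector_matrix_mult_A1 vector_matrix_mult_perm\<close>)
  then show ?thesis ..
qed

lemma rightmost_node_has_one:
  assumes "\<tau>1 \<in> {p_e, p_12, p_13, p_23}"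
  shows "\<exists>i. rightmost_node (p_e, \<tau>0, \<tau>1) n $ i = 1"
proof -
  note simps = vector_matrix_mult_F vector_matrix_mult_A1 vector_matrix_mult_perm
  let ?w = "rightmost_node (p_e, \<tau>0, \<tau>1) n"
  consider "\<tau>1 \<in> {p_e, p_12}" | "\<tau>1 = p_13" | "\<tau>1 = p_23"
    using assms by blast
  then show ?thesis
  proof cases
    case 1
    \<comment> \<open>For \<open>p_12\<close> the two entries swap at each step, so neither equation
      is inductive alone.\<close>
    have "?w $ 1 = 1 \<and> ?w $ 2 = 1"
      unfolding rightmost_node_eq_triangle
      \<comment> \<open>All letters of \<open>replicate n 1\<close> are 1, so only the
        \<open>F1\<close> branch survives.\<close>
      by (rule triangle_invariant) (use 1 in \<open>auto simp: simps split: if_splits\<close>)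
    then show ?thesis by blast
  next
    case 2
    have "?w $ 2 = 1"
      unfolding rightmost_node_eq_triangle
      by (rule triangle_invariant) (use 2 in \<open>auto simp: simps split: if_splits\<close>)
    then show ?thesis ..
  next
    case 3
    have "?w $ 1 = 1"
      unfolding rightmost_node_eq_triangle
      by (rule triangle_invariant) (use 3 in \<open>auto simp: simps split: if_splits\<close>)
    then show ?thesis ..
  qed
qed

lemma min_term_eqI:
  assumes "v \<in> words n" "triangle t v $ i = m"
    and "\<And>u j. u \<in> words n \<Longrightarrow> m \<le> triangle t u $ j"
  shows "min_term t n = m"
  unfolding min_term_def
proof (rule Min_eqI)
  fix y assume "y \<in> (\<lambda>v. Min (range (\<lambda>i. triangle t v $ i))) ` words n"
  then show "m \<le> y"
    using assms(3) by auto
next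
  have "Min (range (\<lambda>i. triangle t v $ i)) = m"
    using assms by (intro Min_eqI) auto
  then show "m \<in> (\<lambda>v. Min (range (\<lambda>i. triangle t v $ i))) ` words n"
    using assms(1) by (rule image_eqI[OF sym])
qed (simp add: finite_words)

theorem theorem17:
  fixes t :: "mat3 \<times> mat3 \<times> mat3" and n :: nat
  assumes "t \<in> {(p_e, p_e, p_e), (p_e, p_e, p_12), (p_e, p_e, p_13), (p_e, p_e, p_23),
                (p_e, p_13, p_e), (p_e, p_13, p_13), (p_e, p_13, p_23),
                (p_e, p_132, p_e), (p_e, p_132, p_12), (p_e, p_132, p_13), (p_e, p_132, p_23)}"
  shows "\<exists>i. rightmost_node t n $ i = min_term t n"
proof -
  \<comment> \<open>The product set is the list together with \<open>(p_e, p_13, p_12)\<close>; it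
    separates the conditions on \<tau>0 and \<tau>1.\<close>
  have t: "t \<in> {p_e} \<times> {p_e, p_13, p_132} \<times> {p_e, p_12, p_13, p_23}"
    using assms by blast
  then obtain i where i: "rightmost_node t n $ i = 1"
    using rightmost_node_has_one by blast
  have "min_term t n = 1"
  proof (rule min_term_eqI)
    show "triangle t (replicate n 1) $ i = 1"
      using i by (simp add: rightmost_node_eq_triangle)
    \<comment> \<open>Over the integers, positivity is the bound 1.\<close>
    show "1 \<le> triangle t u $ j" for u j
      using triangle_pos[OF t, of u j] by simp
  qed (rule replicate_in_words)
  with i show ?thesis
    by auto
qed

end
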